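(* Let $\theta=\{\theta_k\}_{k\in\mathbb Z}$ be an element of $\mathcal S(p,\omega)$ for some $p\in\mathbb N$ and $\omega>0$, and suppose that $\phi\in\mathcal{BPC}(\theta)$ is an asymptotically unpredictable function with values in $\mathbb R^m$. If $\eta\in\mathcal{BPC}(\theta)$ is a function such that the limit $\lim_{t\to\infty}\eta(t)$ exists (in $\mathbb R^m$), then the function $\widetilde\phi\in\mathcal{BPC}(\theta)$ defined by $\widetilde\phi(t)=\phi(t)+\eta(t)$ is also asymptotically unpredictable.
   Context: Vectors carry the Euclidean norm. $\mathcal S(p,\omega)$ is the set of strictly increasing real sequences $\theta=\{\theta_k\}_{k\in\mathbb Z}$ with $\theta_{k+p}=\theta_k+\omega$ for all $k\in\mathbb Z$ ($p\in\mathbb N$, $\omega>0$). $\mathcal{BPC}(\theta)$ is the set of bounded functions $\varphi:\mathbb R\to\mathbb R^m$ such that for each $k\in\mathbb Z$: $\varphi$ is continuous on $(\theta_{k-1},\theta_k)$, the right limit $\varphi(\theta_k+)=\lim_{t\to\theta_k^+}\varphi(t)$ exists, and $\varphi(\theta_k)=\lim_{t\to\theta_k^-}\varphi(t)$. Unpredictable function: $\psi\in\mathcal{BPC}(\theta)$, with $\theta\in\mathcal S(p,\omega)$, is unpredictable if there exist positive numbers $\varepsilon_0,\nu$ and real sequences $\{\mu_n\}_{n\in\mathbb N}$, $\{\tau_n\}_{n\in\mathbb N}$, both diverging to infinity, such that (i) for every $\varepsilon>0$ there is $\delta>0$ with $\|\psi(s_1)-\psi(s_2)\|<\varepsilon$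 whenever $s_1,s_2$ belong to the same interval of continuity (one of the intervals determined by consecutive $\theta_{k-1},\theta_k$) and $|s_1-s_2|<\delta$; (ii) $\|\psi(t+\mu_n)-\psi(t)\|\to0$ as $n\to\infty$ uniformly on compact subsets of $\mathbb R$; (iii) $\|\psi(t+\mu_n)-\psi(t)\|\ge\varepsilon_0$ for each $t\in[\tau_n-\nu,\tau_n+\nu]$ and $n\in\mathbb N$. Asymptotically unpredictable function: $\phi\in\mathcal{BPC}(\theta)$, with $\theta\in\mathcal S(p,\omega)$, is asymptotically unpredictable if $\phi(t)=\psi(t)+\xi(t)$ for all $t\in\mathbb R$, for some unpredictable $\psi\in\mathcal{BPC}(\theta)$ and some $\xi\in\mathcal{BPC}(\theta)$ with $\|\xi(t)\|\to0$ as $t\to\infty$. *)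

theory Defs
  imports "HOL-Analysis.Analysis"
begin

definition periodic_seqs :: "nat \<Rightarrow> real \<Rightarrow> (int \<Rightarrow> real) set" where
  "periodic_seqs p \<omega> = {\<theta>. strict_mono \<theta> \<and> (\<forall>k. \<theta> (k + int p) = \<theta> k + \<omega>)}"

definition BPC :: "(int \<Rightarrow> real) \<Rightarrow> (real \<Rightarrow> real ^ 'm) set" where
  "BPC \<theta> = {\<phi>. bounded (range \<phi>) \<and>
     (\<forall>k. continuous_on {\<theta> (k - 1)<..<\<theta> k} \<phi> \<and>
          (\<exists>l. (\<phi> \<longlongrightarrow> l) (at_right (\<theta> k))) \<and>
          (\<phi> \<longlongrightarrow> \<phi> (\<theta> k)) (at_left (\<theta> k)))}"

text \<open>
  The next two notions are meant for a sequence \<open>\<theta>\<close> in \<open>periodic_seqs p \<omega>\<close> with \<open>p \<ge> 1\<close>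
  and \<open>\<omega> > 0\<close>. Since elements of \<open>BPC \<theta>\<close> are left-continuous at every \<open>\<theta> k\<close>, their intervals of
  continuity are the half-open intervals from \<open>\<theta> (k - 1)\<close> (excluded) to \<open>\<theta> k\<close> (included).
\<close>

definition unpredictable :: "(int \<Rightarrow> real) \<Rightarrow> (real \<Rightarrow> real ^ 'm) \<Rightarrow> bool" where
  "unpredictable \<theta> \<psi> \<longleftrightarrow> \<psi> \<in> BPC \<theta> \<and>
     (\<exists>\<epsilon>\<^sub>0 > 0. \<exists>\<nu> > 0. \<exists>\<mu> \<tau> :: nat \<Rightarrow> real.
        filterlim \<mu> at_top sequentially \<and> filterlim \<tau> at_top sequentially \<and>
        (\<forall>\<epsilon> > 0. \<exists>\<delta> > 0. \<forall>k. \<forall>s\<^sub>1 \<in> {\<theta> (k - 1)<..\<theta> k}. \<forall>s\<^sub>2 \<in> {\<theta> (k - 1)<..\<theta> k}.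
            \<bar>s\<^sub>1 - s\<^sub>2\<bar> < \<delta> \<longrightarrow> norm (\<psi> s\<^sub>1 - \<psi> s\<^sub>2) < \<epsilon>) \<and>
        (\<forall>K. compact K \<longrightarrow>
            uniform_limit K (\<lambda>n t. norm (\<psi> (t + \<mu> n) - \<psi> t)) (\<lambda>_. 0) sequentially) \<and>
        (\<forall>n. \<forall>t \<in> {\<tau> n - \<nu>..\<tau> n + \<nu>}. norm (\<psi> (t + \<mu> n) - \<psi> t) \<ge> \<epsilon>\<^sub>0))"

definition asymptotically_unpredictable :: "(int \<Rightarrow> real) \<Rightarrow> (real \<Rightarrow> real ^ 'm) \<Rightarrow> bool" where
  "asymptotically_unpredictable \<theta> \<phi> \<longleftrightarrow> \<phi> \<in> BPC \<theta> \<and>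
     (\<exists>\<psi> \<xi>. unpredictable \<theta> \<psi> \<and> \<xi> \<in> BPC \<theta> \<and>
        ((\<lambda>t. norm (\<xi> t)) \<longlongrightarrow> 0) at_top \<and> (\<forall>t. \<phi> t = \<psi> t + \<xi> t))"

end

theory Submission
  imports Defs
begin

text \<open>
  Translating an unpredictable function by a constant leaves all its differences unchanged, so the
  limit of \<open>\<eta>\<close> can be absorbed into the unpredictable part of \<open>\<phi>\<close> and the remainder of \<open>\<eta>\<close> into
  the vanishing part.
\<close>

lemma BPC_add:
  assumes "f \<in> BPC \<theta>" and "g \<in> BPC \<theta>"
  shows "(\<lambda>t. f t + g t) \<in> BPC \<theta>"
proof -
  have "bounded (range (\<lambda>t. f t + g t))"
    using assms by (auto simp: BPC_def intro: bounded_plus_comp)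
  \<comment> \<open>The right limit is the one existential clause of \<open>BPC\<close>: its witness
    is the sum of the two right limits.\<close>
  moreover have "\<exists>l. ((\<lambda>t. f t + g t) \<longlongrightarrow> l) (at_right (\<theta> k))" for k
    using assms unfolding BPC_def by (blast intro: tendsto_add)
  ultimately show ?thesis
    using assms by (simp add: BPC_def continuous_on_add tendsto_add)
qed

lemma BPC_const: "(\<lambda>_. c) \<in> BPC \<theta>"
  by (auto simp: BPC_def)

lemma unpredictable_add_const:
  assumes "unpredictable \<theta> \<psi>"
  shows "unpredictable \<theta> (\<lambda>t. \<psi> t + c)"
proof -
  have "(\<lambda>t. \<psi> t + c) \<in> BPC \<theta>"
    using assms by (intro BPC_add BPC_const) (simp add: unpredictable_def)
  \<comment> \<open>Once c cancels in each difference, the remaining clauses are literally those for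
    \<open>\<psi>\<close>, so the same \<open>\<epsilon>\<^sub>0\<close>, \<open>\<nu>\<close>,
    \<open>\<mu>\<close> and \<open>\<tau>\<close> serve; only membership in \<open>BPC\<close> has
    to be supplied anew.\<close>
  with assms show ?thesis
    by (simp only: unpredictable_def add_diff_cancel_right simp_thms)
qed

theorem lemma2p2:
  fixes p :: nat and \<omega> :: real and \<theta> :: "int \<Rightarrow> real"
    and \<phi> \<eta> :: "real \<Rightarrow> real ^ 'm"
  assumes "p \<ge> 1" and "\<omega> > 0" and "\<theta> \<in> periodic_seqs p \<omega>"
    and "\<phi> \<in> BPC \<theta>" and "asymptotically_unpredictable \<theta> \<phi>"
    and "\<eta> \<in> BPC \<theta>" and "\<exists>L. (\<eta> \<longlongrightarrow> L) at_top"
  shows "(\<lambda>t. \<phi> t + \<eta> t) \<in> BPC \<theta> \<and> asymptotically_unpredictable \<theta> (\<lambda>t. \<phi> t + \<eta> t)"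
proof -
  obtain L where L: "(\<eta> \<longlongrightarrow> L) at_top"
    using assms(7) by blast
  obtain \<psi> \<xi> where \<psi>: "unpredictable \<theta> \<psi>" and \<xi>: "\<xi> \<in> BPC \<theta>"
    and lim: "((\<lambda>t. norm (\<xi> t)) \<longlongrightarrow> 0) at_top" and eq: "\<And>t. \<phi> t = \<psi> t + \<xi> t"
    using assms(5) unfolding asymptotically_unpredictable_def by blast
  \<comment> \<open>Adding \<open>- L\<close> rather than subtracting L lets \<open>BPC_add\<close>,
    \<open>BPC_const\<close> and \<open>tendsto_add\<close> apply directly.\<close>
  define \<zeta> where "\<zeta> t = \<xi> t + (\<eta> t + (- L))" for t
  have sum: "(\<lambda>t. \<phi> t + \<eta> t) \<in> BPC \<theta>"
    by (rule BPC_add[OF assms(4,6)])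
  have "\<zeta> \<in> BPC \<theta>"
    unfolding \<zeta>_def by (intro BPC_add BPC_const \<xi> assms(6))
  moreover have "((\<lambda>t. norm (\<zeta> t)) \<longlongrightarrow> 0) at_top"
  proof -
    \<comment> \<open>The limit is left unsimplified to mirror the shape of \<open>\<zeta>\<close>;
      the vanishing norm of \<open>\<xi>\<close> is first turned into convergence of
      \<open>\<xi>\<close> itself to 0.\<close>
    have "(\<zeta> \<longlongrightarrow> 0 + (L + (- L))) at_top"
      unfolding \<zeta>_def by (intro tendsto_add tendsto_const L tendsto_norm_zero_cancel[OF lim])
    then show ?thesis
      by (simp add: tendsto_norm_zero)
  qed
  moreover have "\<phi> t + \<eta> t = (\<psi> t + L) + \<zeta> t" for t
    by (simp add: eq \<zeta>_def)
  ultimately show ?thesis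
    unfolding asymptotically_unpredictable_def
    using sum unpredictable_add_const[OF \<psi>, of L] by blast
qed

end
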